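(* Let $\alpha,\beta\ge 0$ and let $u$ be the solution of $-u_{xx}+\alpha u_x+\beta u=f$ on $(0,1)$, $u(0)=u(1)=0$. Assume $u\in C^3([0,1])$. Then there is a constant $c>0$, independent of the mesh $\tau$, such that for every admissible mesh $\tau$ of $(0,1)$ of size $h$, the first correction $(u^1_i)_{i=0}^{N+1}$ (defined in the context) satisfies $$\left(\sum_{i=0}^{N}\frac{(e^1_{i+1}-e^1_i)^2}{h_{i+\frac12}}\right)^{\frac12}\le c\,h^2\,\|u\|_{3,\infty,[0,1]},$$ where $e^1_i=u^1_i-u(x_i)$ for $0\le i\le N+1$; that is, the error in the first correction is of order $O(h^2)$ in the discrete $H^1_0$ norm.
   Context: **Norm.** $\|w\|_{m,\infty,[0,1]}=\max_{0\le a\le m}\max_{[0,1]}|w^{(a)}|$. Subscripts $x$, $xx$ denote derivatives. Since $u\in C^3([0,1])$, $f=-u_{xx}+\alpha u_x+\beta u$ is regarded as a function on $[0,1]$ (extended by continuity). **Admissible mesh $\tau$.** $N\in\mathbb N^*$ and points $x_0=x_{\frac12}=0<x_1<x_{\frac32}<\dots<x_{i-\frac12}<x_i<x_{i+\frac12}<\dots<x_N<x_{N+\frac12}=x_{N+1}=1$. Put $K_i=(x_{i-\frac12},x_{i+\frac12})$, $h_i=x_{i+\frac12}-x_{i-\frac12}$, $h_i^-=x_i-x_{i-\frac12}$, $h_i^+=x_{i+\frac12}-x_i$ for $1\le i\le N$; $h_0^+=h_{N+1}^-=0$; $h_{i+\frac12}=x_{i+1}-x_i$ for $0\le i\le N$;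 $h=\max_{1\le i\le N}h_i$. **Basic finite volume solution** $(u_i)_{i=0}^{N+1}$: $u_0=u_{N+1}=0$ and for $1\le i\le N$ $$-\frac{u_{i+1}-u_i}{h_{i+\frac12}}+\frac{u_i-u_{i-1}}{h_{i-\frac12}}+\alpha(u_i-u_{i-1})+\beta h_iu_i=\int_{K_i}f\,dx.$$ Put $\partial_1u_i=\dfrac{u_{i+1}-u_i}{h_{i+\frac12}}$, $0\le i\le N$. **First correction** $(u_i^1)_{i=0}^{N+1}$: $u_0^1=u_{N+1}^1=0$ and for $1\le i\le N$ $$\begin{aligned} -\frac{u^1_{i+1}-u^1_i}{h_{i+\frac12}}&+\frac{u^1_i-u^1_{i-1}}{h_{i-\frac12}}+\alpha(u^1_i-u^1_{i-1})+\beta h_iu^1_i=\int_{K_i}f\,dx\\ &-\frac{h_{i+1}^--h_i^+}{2}\big(\alpha\,\partial_1u_i+\beta u_i-f(x_{i+\frac12})\big)+\frac{h_i^--h_{i-1}^+}{2}\big(\alpha\,\partial_1u_{i-1}+\beta u_{i-1}-f(x_{i-\frac12})\big)\\ &-\alpha h_i^+\partial_1u_i+\alpha h_{i-1}^+\partial_1u_{i-1}-\frac{\beta}{2}\big((h_i^+)^2\partial_1u_i-(h_i^-)^2\partial_1u_{i-1}\big). \end{aligned}$$ *)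

theory Defs
  imports "HOL-Analysis.Analysis"
begin

text \<open>The \<open>k\<close>-th derivative of \<open>w\<close> relative to \<open>S\<close>. For \<open>S = {0..1}\<close> the derivatives at the
  endpoints are one-sided. They are the continuous extensions of the interior derivatives
  whenever \<open>C_on k S w\<close>. Values outside \<open>S\<close> are meaningless.\<close>

definition nderiv_on :: "real set \<Rightarrow> nat \<Rightarrow> (real \<Rightarrow> real) \<Rightarrow> real \<Rightarrow> real" where
  "nderiv_on S k w = ((\<lambda>v x. vector_derivative v (at x within S)) ^^ k) w"

definition C_on :: "nat \<Rightarrow> real set \<Rightarrow> (real \<Rightarrow> real) \<Rightarrow> bool" where
  "C_on m S w \<longleftrightarrow>
     (\<forall>k<m. nderiv_on S k w differentiable_on S) \<and> (\<forall>k\<le>m. continuous_on S (nderiv_on S k w))"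

text \<open>The inner supremum is attained, i.e. is a maximum, when \<open>S\<close> is compact and nonempty and
  \<open>C_on m S w\<close>.\<close>

definition Cnorm :: "nat \<Rightarrow> real set \<Rightarrow> (real \<Rightarrow> real) \<Rightarrow> real" where
  "Cnorm m S w = Max ((\<lambda>k. SUP x\<in>S. \<bar>nderiv_on S k w x\<bar>) ` {..m})"

text \<open>Continuity of \<open>f\<close> on the closed interval together with the equation on the open interval
  says that \<open>f\<close> is \<open>- u'' + \<alpha> u' + \<beta> u\<close> extended by continuity to the endpoints.\<close>

definition bvp_solution :: "real \<Rightarrow> real \<Rightarrow> (real \<Rightarrow> real) \<Rightarrow> (real \<Rightarrow> real) \<Rightarrow> bool" where
  "bvp_solution \<alpha> \<beta> f u \<longleftrightarrow>
     continuous_on {0..1} f \<and>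
     (\<forall>x\<in>{0<..<1}.
        - nderiv_on {0..1} 2 u x + \<alpha> * nderiv_on {0..1} 1 u x + \<beta> * u x = f x) \<and>
     u 0 = 0 \<and> u 1 = 0"

text \<open>A mesh is given by \<open>N\<close>, the nodes \<open>x i\<close> (\<open>0 \<le> i \<le> N + 1\<close>) and the cell faces \<open>y i\<close>
  (\<open>0 \<le> i \<le> N\<close>), where \<open>y i\<close> stands for the point with index \<open>i + 1/2\<close>.\<close>

definition admissible_mesh :: "nat \<Rightarrow> (nat \<Rightarrow> real) \<Rightarrow> (nat \<Rightarrow> real) \<Rightarrow> bool" where
  "admissible_mesh N x y \<longleftrightarrow>
     1 \<le> N \<and> x 0 = 0 \<and> y 0 = 0 \<and> y N = 1 \<and> x (N + 1) = 1 \<and>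
     (\<forall>i\<in>{1..N}. y (i - 1) < x i \<and> x i < y i)"

definition cell :: "(nat \<Rightarrow> real) \<Rightarrow> nat \<Rightarrow> real set" where
  "cell y i = {y (i - 1)<..<y i}"

definition cell_size :: "(nat \<Rightarrow> real) \<Rightarrow> nat \<Rightarrow> real" where
  "cell_size y i = y i - y (i - 1)"

text \<open>\<open>h_minus x y i\<close> is used for \<open>1 \<le> i \<le> N + 1\<close> and \<open>h_plus x y i\<close> for \<open>0 \<le> i \<le> N\<close>.
  On an admissible mesh these formulas yield \<open>h_plus x y 0 = 0\<close> and
  \<open>h_minus x y (N + 1) = 0\<close>.\<close>

definition h_minus :: "(nat \<Rightarrow> real) \<Rightarrow> (nat \<Rightarrow> real) \<Rightarrow> nat \<Rightarrow> real" where
  "h_minus x y i = x i - y (i - 1)"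

definition h_plus :: "(nat \<Rightarrow> real) \<Rightarrow> (nat \<Rightarrow> real) \<Rightarrow> nat \<Rightarrow> real" where
  "h_plus x y i = y i - x i"

text \<open>\<open>h_half x i\<close> is the step with index \<open>i + 1/2\<close>.\<close>

definition h_half :: "(nat \<Rightarrow> real) \<Rightarrow> nat \<Rightarrow> real" where
  "h_half x i = x (i + 1) - x i"

definition mesh_size :: "nat \<Rightarrow> (nat \<Rightarrow> real) \<Rightarrow> real" where
  "mesh_size N y = Max (cell_size y ` {1..N})"

definition diffq :: "(nat \<Rightarrow> real) \<Rightarrow> (nat \<Rightarrow> real) \<Rightarrow> nat \<Rightarrow> real" where
  "diffq x U i = (U (i + 1) - U i) / h_half x i"

definition fv_op ::
  "real \<Rightarrow> real \<Rightarrow> (nat \<Rightarrow> real) \<Rightarrow> (nat \<Rightarrow> real) \<Rightarrow> (nat \<Rightarrow> real) \<Rightarrow> nat \<Rightarrow> real" where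
  "fv_op \<alpha> \<beta> x y U i =
     - (U (i + 1) - U i) / h_half x i + (U i - U (i - 1)) / h_half x (i - 1)
     + \<alpha> * (U i - U (i - 1)) + \<beta> * cell_size y i * U i"

definition fv_solution ::
  "real \<Rightarrow> real \<Rightarrow> (real \<Rightarrow> real) \<Rightarrow> nat \<Rightarrow> (nat \<Rightarrow> real) \<Rightarrow> (nat \<Rightarrow> real) \<Rightarrow> (nat \<Rightarrow> real) \<Rightarrow> bool" where
  "fv_solution \<alpha> \<beta> f N x y U \<longleftrightarrow>
     U 0 = 0 \<and> U (N + 1) = 0 \<and>
     (\<forall>i\<in>{1..N}. fv_op \<alpha> \<beta> x y U i = integral (cell y i) f)"

text \<open>\<open>U\<close> is the basic finite volume solution, \<open>V\<close> its first correction.\<close>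

definition first_correction ::
  "real \<Rightarrow> real \<Rightarrow> (real \<Rightarrow> real) \<Rightarrow> nat \<Rightarrow> (nat \<Rightarrow> real) \<Rightarrow> (nat \<Rightarrow> real) \<Rightarrow>
   (nat \<Rightarrow> real) \<Rightarrow> (nat \<Rightarrow> real) \<Rightarrow> bool" where
  "first_correction \<alpha> \<beta> f N x y U V \<longleftrightarrow>
     V 0 = 0 \<and> V (N + 1) = 0 \<and>
     (\<forall>i\<in>{1..N}. fv_op \<alpha> \<beta> x y V i =
        integral (cell y i) f
        - (h_minus x y (i + 1) - h_plus x y i) / 2
            * (\<alpha> * diffq x U i + \<beta> * U i - f (y i))
        + (h_minus x y i - h_plus x y (i - 1)) / 2
            * (\<alpha> * diffq x U (i - 1) + \<beta> * U (i - 1) - f (y (i - 1)))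
        - \<alpha> * h_plus x y i * diffq x U i
        + \<alpha> * h_plus x y (i - 1) * diffq x U (i - 1)
        - \<beta> / 2 * ((h_plus x y i)^2 * diffq x U i - (h_minus x y i)^2 * diffq x U (i - 1)))"

end

theory Submission
  imports Defs
begin

text \<open>The scheme is conservative, so the proof works with fluxes. Integrating the differential
  equation over a cell and subtracting the scheme shows that the error \<open>e\<close> of either discrete
  solution obeys the scheme with a right-hand side of the form \<open>P i - P (i - 1) + Q i\<close>: a
  difference of flux errors and a small volume term. Testing with \<open>e\<close> itself and summing by
  parts, as in the continuous energy estimate, bounds the discrete \<open>H1_0\<close> norm of \<open>e\<close> by the
  weighted \<open>L2\<close> norm of \<open>P\<close> plus the sum of the \<open>\<bar>Q i\<bar>\<close> (\<open>stability\<close>). The upwind term can only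
  help, because it adds half the sum of the squared jumps of \<open>e\<close>.

  For the basic solution, Taylor expansion at the faces gives \<open>P = O(h)\<close> and \<open>Q i = O(h h_i)\<close>,
  hence an error of first order (\<open>basic_error\<close>). The right-hand side of the first correction
  contains the leading parts of these defects: the face \<open>y i\<close> need not lie midway between
  \<open>x i\<close> and \<open>x (i + 1)\<close>, the convective flux is taken upstream at \<open>x i\<close> rather than at \<open>y i\<close>, and
  \<open>x i\<close> need not be the midpoint of its cell. In these leading parts \<open>u''\<close> has been replaced through
  the differential equation, so that they involve only \<open>u\<close>, \<open>u'\<close> and \<open>f\<close>, and then \<open>u\<close> and
  \<open>u'\<close> by the basic solution and its difference quotients. What is left in \<open>P\<close> is a Taylor
  remainder of second order plus \<open>h\<close> times the error of the basic solution, again of second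
  order by the previous step; in the same way \<open>Q i\<close> becomes \<open>O(h\<^sup>2 h_i)\<close> plus \<open>h\<close> times local
  errors of the basic solution that add up to its discrete norm (\<open>correction_error\<close>).\<close>

section \<open>Taylor estimates on the unit interval\<close>

text \<open>Only the powers of \<open>t - s\<close> matter for the order of convergence. The numerical factors are
  those of \<open>field_Taylor\<close>, which bounds the remainder by one factorial less than the Lagrange
  form.\<close>

lemma taylor_1:
  fixes g g' :: "real \<Rightarrow> real"
  assumes g: "\<And>t. t \<in> {0..1} \<Longrightarrow> (g has_real_derivative g' t) (at t within {0..1})"
    and bound: "\<And>t. t \<in> {0..1} \<Longrightarrow> \<bar>g' t\<bar> \<le> M"
    and st: "s \<in> {0..1}" "t \<in> {0..1}"
  shows "\<bar>g t - g s\<bar> \<le> M * \<bar>t - s\<bar>"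
  using field_Taylor[of "{0..1}" 0 "\<lambda>i. if i = 0 then g else g'" M s t] assms by simp

lemma taylor_2:
  fixes g g' g'' :: "real \<Rightarrow> real"
  assumes g: "\<And>t. t \<in> {0..1} \<Longrightarrow> (g has_real_derivative g' t) (at t within {0..1})"
    and g': "\<And>t. t \<in> {0..1} \<Longrightarrow> (g' has_real_derivative g'' t) (at t within {0..1})"
    and bound: "\<And>t. t \<in> {0..1} \<Longrightarrow> \<bar>g'' t\<bar> \<le> M"
    and st: "s \<in> {0..1}" "t \<in> {0..1}"
  shows "\<bar>g t - g s - (t - s) * g' s\<bar> \<le> M * (t - s)\<^sup>2"
proof -
  let ?f = "\<lambda>i::nat. if i = 0 then g else if i = 1 then g' else g''"
  have "norm (?f 0 t - (\<Sum>i\<le>1. ?f i s * (t - s) ^ i / fact i))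
      \<le> M * norm (t - s) ^ Suc 1 / fact 1"
  proof (rule field_Taylor[of "{0..1}"])
    show "(?f i has_real_derivative ?f (Suc i) z) (at z within {0..1})"
      if "z \<in> {0..1}" "i \<le> 1" for i z
      using that g g' by (cases i) auto
  qed (use bound st in auto)
  then show ?thesis
    by (simp add: power2_eq_square algebra_simps flip: abs_mult)
qed

lemma taylor_3:
  fixes g g' g'' g3 :: "real \<Rightarrow> real"
  assumes g: "\<And>t. t \<in> {0..1} \<Longrightarrow> (g has_real_derivative g' t) (at t within {0..1})"
    and g': "\<And>t. t \<in> {0..1} \<Longrightarrow> (g' has_real_derivative g'' t) (at t within {0..1})"
    and g'': "\<And>t. t \<in> {0..1} \<Longrightarrow> (g'' has_real_derivative g3 t) (at t within {0..1})"
    and bound: "\<And>t. t \<in> {0..1} \<Longrightarrow> \<bar>g3 t\<bar> \<le> M"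
    and st: "s \<in> {0..1}" "t \<in> {0..1}"
  shows "\<bar>g t - g s - (t - s) * g' s - (t - s)\<^sup>2 / 2 * g'' s\<bar> \<le> M / 2 * \<bar>t - s\<bar> ^ 3"
proof -
  let ?f = "\<lambda>i::nat. if i = 0 then g else if i = 1 then g' else if i = 2 then g'' else g3"
  have "norm (?f 0 t - (\<Sum>i\<le>2. ?f i s * (t - s) ^ i / fact i))
      \<le> M * norm (t - s) ^ Suc 2 / fact 2"
  proof (rule field_Taylor[of "{0..1}"])
    show "(?f i has_real_derivative ?f (Suc i) z) (at z within {0..1})"
      if "z \<in> {0..1}" "i \<le> 2" for i z
    proof -
      from that(2) consider "i = 0" | "i = 1" | "i = 2" by linarith
      then show ?thesis using that(1) g g' g'' by cases auto
    qed
  qed (use bound st in auto)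
  then show ?thesis
    by (simp add: numeral_2_eq_2 numeral_3_eq_3 algebra_simps)
qed

text \<open>A difference quotient across a face splits into the contributions of the two sides, each
  divided by the whole step. An error bound proportional to the length of each side therefore
  survives the division, however unequal the sides are.\<close>

lemma abs_two_sided_quotient_le:
  fixes E F a b C :: real
  assumes "\<bar>E\<bar> \<le> C * b" "\<bar>F\<bar> \<le> C * a" "0 < a + b"
  shows "\<bar>(E - F) / (a + b)\<bar> \<le> C"
proof -
  have "\<bar>E - F\<bar> \<le> C * (a + b)"
    using assms by (simp add: algebra_simps)
  then show ?thesis
    using assms(3) by (simp add: pos_divide_le_eq)
qed

section \<open>The weighted norm of fluxes\<close>

text \<open>The discrete \<open>H1_0\<close> norm of \<open>e\<close> is \<open>flux_norm N x (diffq x e)\<close>. Going through \<open>L2_set\<close>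
  gives the inequalities of Minkowski and Cauchy-Schwarz.\<close>

definition flux_norm :: "nat \<Rightarrow> (nat \<Rightarrow> real) \<Rightarrow> (nat \<Rightarrow> real) \<Rightarrow> real" where
  "flux_norm N x p = L2_set (\<lambda>i. sqrt (h_half x i) * p i) {0..N}"

lemma flux_norm_nonneg: "0 \<le> flux_norm N x p"
  by (simp add: flux_norm_def)

lemma summation_by_parts:
  fixes e P :: "nat \<Rightarrow> real"
  shows "(\<Sum>i=1..n. e i * (P i - P (i - 1)))
    = e (n + 1) * P n - e 0 * P 0 - (\<Sum>i=0..n. P i * (e (i + 1) - e i))"
  by (induction n) (simp_all add: algebra_simps)

text \<open>This is half the telescoping sum of the squares plus half the sum of the squared jumps.\<close>

lemma upwind_nonneg:
  fixes e :: "nat \<Rightarrow> real"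
  assumes "e 0 = 0"
  shows "0 \<le> (\<Sum>i=1..n. e i * (e i - e (i - 1)))"
proof -
  have "(e n)\<^sup>2 / 2 \<le> (\<Sum>i=1..n. e i * (e i - e (i - 1)))"
  proof (induction n)
    case 0
    then show ?case by (simp add: assms)
  next
    case (Suc n)
    have "(e n)\<^sup>2 / 2 + e (Suc n) * (e (Suc n) - e n) - (e (Suc n))\<^sup>2 / 2
        = (e (Suc n) - e n)\<^sup>2 / 2"
      by (simp add: power2_eq_square field_simps)
    moreover have "0 \<le> (e (Suc n) - e n)\<^sup>2 / 2" by simp
    ultimately have "(e (Suc n))\<^sup>2 / 2 \<le> (e n)\<^sup>2 / 2 + e (Suc n) * (e (Suc n) - e n)"
      by linarith
    then show ?case using Suc by simp
  qed
  moreover have "0 \<le> (e n)\<^sup>2 / 2" by simp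
  ultimately show ?thesis by linarith
qed

lemma fv_op_flux_form:
  assumes "1 \<le> i"
  shows "fv_op \<alpha> \<beta> x y e i
    = - (diffq x e i - diffq x e (i - 1)) + \<alpha> * (e i - e (i - 1)) + \<beta> * cell_size y i * e i"
  using assms by (simp add: fv_op_def diffq_def minus_divide_left)

lemma fv_op_diff:
  "fv_op \<alpha> \<beta> x y (\<lambda>i. v i - w i) i = fv_op \<alpha> \<beta> x y v i - fv_op \<alpha> \<beta> x y w i"
  by (simp add: fv_op_def diff_divide_distrib add_divide_distrib algebra_simps)

lemma diffq_diff: "diffq x (\<lambda>i. v i - w i) i = diffq x v i - diffq x w i"
  by (simp add: diffq_def diff_divide_distrib)

section \<open>Admissible meshes and stability of the scheme\<close>

locale mesh =
  fixes N :: nat and x y :: "nat \<Rightarrow> real"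
  assumes admissible: "admissible_mesh N x y"
begin

abbreviation h :: real where "h \<equiv> mesh_size N y"

lemma x_0: "x 0 = 0" and y_0: "y 0 = 0" and y_N: "y N = 1" and x_Suc_N: "x (N + 1) = 1"
  and N_pos: "1 \<le> N"
  using admissible by (auto simp: admissible_mesh_def)

lemma node_between: "y (i - 1) < x i" "x i < y i" if "1 \<le> i" "i \<le> N"
  using admissible that by (auto simp: admissible_mesh_def)

lemma y_mono: "y i \<le> y j" if "i \<le> j" "j \<le> N"
  using that
proof (induction j rule: dec_induct)
  case base
  then show ?case by simp
next
  case (step n)
  then show ?case using node_between[of "Suc n"] by simp
qed

lemma y_unit: "y i \<in> {0..1}" if "i \<le> N"
  using y_mono[of 0 i] y_mono[of i N] that y_0 y_N by simp

lemma x_unit: "x i \<in> {0..1}" if "i \<le> N + 1"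
proof (cases "i = 0 \<or> i = N + 1")
  case True
  then show ?thesis using x_0 x_Suc_N by auto
next
  case False
  then have i: "1 \<le> i" "i \<le> N" "i - 1 \<le> N" using that by auto
  show ?thesis
    using node_between[OF i(1,2)] y_unit[OF i(2)] y_unit[OF i(3)] by simp
qed

lemma cell_size_le_h: "cell_size y i \<le> h" if "1 \<le> i" "i \<le> N"
  unfolding mesh_size_def using that by (intro Max_ge) auto

lemma cell_size_split: "cell_size y i = h_plus x y i + h_minus x y i"
  by (simp add: cell_size_def h_plus_def h_minus_def)

lemma h_plus_pos: "0 < h_plus x y i" and h_minus_pos: "0 < h_minus x y i" if "1 \<le> i" "i \<le> N"
  using node_between[OF that] by (auto simp: h_plus_def h_minus_def)

lemma h_pos: "0 < h"
  using cell_size_le_h[of 1] cell_size_split[of 1] h_plus_pos[of 1] h_minus_pos[of 1] N_pos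
  by simp

lemma h_plus_bounds: "0 \<le> h_plus x y i" "h_plus x y i \<le> h" if "i \<le> N"
proof -
  have "0 \<le> h_plus x y i \<and> h_plus x y i \<le> h"
  proof (cases "i = 0")
    case True
    then show ?thesis using h_pos by (simp add: h_plus_def x_0 y_0)
  next
    case False
    then have i: "1 \<le> i" "i \<le> N" using that by auto
    show ?thesis
      using h_plus_pos[OF i] h_minus_pos[OF i] cell_size_le_h[OF i] cell_size_split[of i] by simp
  qed
  then show "0 \<le> h_plus x y i" "h_plus x y i \<le> h" by auto
qed

lemma h_minus_bounds: "0 \<le> h_minus x y (i + 1)" "h_minus x y (i + 1) \<le> h" if "i \<le> N"
proof -
  have "0 \<le> h_minus x y (i + 1) \<and> h_minus x y (i + 1) \<le> h"
  proof (cases "i = N")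
    case True
    then show ?thesis using h_pos x_Suc_N y_N by (simp add: h_minus_def)
  next
    case False
    then have i: "1 \<le> i + 1" "i + 1 \<le> N" using that by auto
    show ?thesis
      using h_plus_pos[OF i] h_minus_pos[OF i] cell_size_le_h[OF i] cell_size_split[of "i + 1"]
      by simp
  qed
  then show "0 \<le> h_minus x y (i + 1)" "h_minus x y (i + 1) \<le> h" by auto
qed

lemma h_half_split: "h_half x i = h_plus x y i + h_minus x y (i + 1)"
  by (simp add: h_half_def h_plus_def h_minus_def)

lemma h_half_pos: "0 < h_half x i" if "i \<le> N"
proof (cases "i = 0")
  case True
  then show ?thesis
    using h_minus_pos[of 1] N_pos h_plus_bounds(1)[of 0] by (simp add: h_half_split)
next
  case False
  then show ?thesis
    using h_plus_pos[of i] h_minus_bounds(1)[OF that] that h_half_split[of i] by linarith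
qed

lemma sum_h_half: "(\<Sum>i=0..N. h_half x i) = 1"
  using sum_Suc_diff[of 0 N x] x_0 x_Suc_N by (simp add: h_half_def)

lemma sum_cell_size: "(\<Sum>i=1..N. cell_size y i) = 1"
  using sum_telescope''[of 0 N y] y_0 y_N by (simp add: cell_size_def)

lemma flux_norm_triangle:
  "flux_norm N x (\<lambda>i. p i + q i) \<le> flux_norm N x p + flux_norm N x q"
  unfolding flux_norm_def distrib_left by (rule L2_set_triangle_ineq)

lemma flux_norm_mono:
  assumes "\<And>i. i \<le> N \<Longrightarrow> \<bar>p i\<bar> \<le> q i"
  shows "flux_norm N x p \<le> flux_norm N x q"
proof -
  have "flux_norm N x p = L2_set (\<lambda>i. \<bar>sqrt (h_half x i) * p i\<bar>) {0..N}"
    by (simp add: flux_norm_def L2_set_def)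
  also have "\<dots> \<le> flux_norm N x q"
    unfolding flux_norm_def
    using assms h_half_pos
    by (intro L2_set_mono) (auto simp: abs_mult less_imp_le intro!: mult_left_mono)
  finally show ?thesis .
qed

lemma flux_norm_scale: "flux_norm N x (\<lambda>i. c * p i) = c * flux_norm N x p" if "0 \<le> c"
  unfolding flux_norm_def using that by (simp add: L2_set_right_distrib mult.left_commute)

lemma flux_norm_abs: "flux_norm N x (\<lambda>i. \<bar>p i\<bar>) = flux_norm N x p"
  by (simp add: flux_norm_def L2_set_def power_mult_distrib)

lemma flux_norm_square: "(flux_norm N x p)\<^sup>2 = (\<Sum>i=0..N. h_half x i * (p i)\<^sup>2)"
proof -
  have "(\<Sum>i=0..N. (sqrt (h_half x i) * p i)\<^sup>2) = (\<Sum>i=0..N. h_half x i * (p i)\<^sup>2)"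
    using h_half_pos by (intro sum.cong) (auto simp: power_mult_distrib less_imp_le)
  moreover have "0 \<le> (\<Sum>i=0..N. (sqrt (h_half x i) * p i)\<^sup>2)"
    by (simp add: sum_nonneg)
  ultimately show ?thesis
    by (simp add: flux_norm_def L2_set_def)
qed

lemma flux_norm_const: "flux_norm N x (\<lambda>_. c) = \<bar>c\<bar>"
proof -
  have "(flux_norm N x (\<lambda>_. c))\<^sup>2 = \<bar>c\<bar>\<^sup>2"
    unfolding flux_norm_square by (simp add: sum_h_half flip: sum_distrib_right)
  then show ?thesis
    by (rule power2_eq_imp_eq) (simp_all add: flux_norm_nonneg)
qed

lemma flux_cauchy_schwarz:
  "(\<Sum>i=0..N. h_half x i * (\<bar>p i\<bar> * \<bar>q i\<bar>)) \<le> flux_norm N x p * flux_norm N x q"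
proof -
  have "(\<Sum>i=0..N. h_half x i * (\<bar>p i\<bar> * \<bar>q i\<bar>))
      = (\<Sum>i=0..N. \<bar>sqrt (h_half x i) * p i\<bar> * \<bar>sqrt (h_half x i) * q i\<bar>)"
  proof (rule sum.cong)
    fix i assume "i \<in> {0..N}"
    then have "sqrt (h_half x i) * sqrt (h_half x i) = h_half x i" "0 \<le> h_half x i"
      using h_half_pos[of i] by (auto simp: less_imp_le)
    then show "h_half x i * (\<bar>p i\<bar> * \<bar>q i\<bar>)
        = \<bar>sqrt (h_half x i) * p i\<bar> * \<bar>sqrt (h_half x i) * q i\<bar>"
      by (simp add: abs_mult)
  qed simp
  also have "\<dots> \<le> flux_norm N x p * flux_norm N x q"
    unfolding flux_norm_def by (rule L2_set_mult_ineq)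
  finally show ?thesis .
qed

lemma flux_sum_le: "(\<Sum>i=0..N. h_half x i * \<bar>p i\<bar>) \<le> flux_norm N x p"
  using flux_cauchy_schwarz[of p "\<lambda>_. 1"] flux_norm_const[of 1] by simp

lemma diffq_step: "e (i + 1) - e i = h_half x i * diffq x e i" if "i \<le> N"
  using h_half_pos[OF that] by (simp add: diffq_def)

lemma flux_norm_diffq:
  "flux_norm N x (diffq x e) = sqrt (\<Sum>i=0..N. (e (i + 1) - e i)\<^sup>2 / h_half x i)"
proof -
  have "(flux_norm N x (diffq x e))\<^sup>2 = (\<Sum>i=0..N. (e (i + 1) - e i)\<^sup>2 / h_half x i)"
    unfolding flux_norm_square
    using h_half_pos
    by (intro sum.cong) (auto simp: diffq_def power_divide power2_eq_square)
  then show ?thesis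
    using flux_norm_nonneg by (metis real_sqrt_unique)
qed

text \<open>The discrete Poincare inequality in the maximum norm: the value is the sum of the jumps
  from the boundary, and the steps add up to the length one of the interval.\<close>

lemma abs_le_flux_norm_diffq:
  assumes "e 0 = 0" "i \<le> N + 1"
  shows "\<bar>e i\<bar> \<le> flux_norm N x (diffq x e)"
proof -
  have "\<bar>e i\<bar> = \<bar>\<Sum>j<i. e (j + 1) - e j\<bar>"
    using sum_lessThan_telescope[of e i] assms(1) by simp
  also have "\<dots> \<le> (\<Sum>j<i. \<bar>e (j + 1) - e j\<bar>)"
    by (rule sum_abs)
  also have "\<dots> \<le> (\<Sum>j=0..N. \<bar>e (j + 1) - e j\<bar>)"
    using assms(2) by (intro sum_mono2) auto
  also have "\<dots> = (\<Sum>j=0..N. h_half x j * \<bar>diffq x e j\<bar>)"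
    using h_half_pos diffq_step by (intro sum.cong) (auto simp: abs_mult less_imp_le)
  also have "\<dots> \<le> flux_norm N x (diffq x e)"
    by (rule flux_sum_le)
  finally show ?thesis .
qed

text \<open>The energy estimate. Testing with \<open>e\<close> turns the diffusive flux into the squared norm of
  \<open>diffq x e\<close>, while the convective and reactive terms are nonnegative and can be dropped.\<close>

lemma stability:
  assumes coeffs: "0 \<le> \<alpha>" "0 \<le> \<beta>"
    and boundary: "e 0 = 0" "e (N + 1) = 0"
    and scheme: "\<And>i. 1 \<le> i \<Longrightarrow> i \<le> N \<Longrightarrow> fv_op \<alpha> \<beta> x y e i = P i - P (i - 1) + Q i"
  shows "flux_norm N x (diffq x e) \<le> flux_norm N x P + (\<Sum>i=1..N. \<bar>Q i\<bar>)"
proof -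
  let ?D = "diffq x e"
  let ?n = "flux_norm N x ?D"
  have parts: "(\<Sum>i=1..N. e i * (p i - p (i - 1))) = - (\<Sum>i=0..N. h_half x i * (p i * ?D i))"
    for p
  proof -
    have "(\<Sum>i=0..N. p i * (e (i + 1) - e i)) = (\<Sum>i=0..N. h_half x i * (p i * ?D i))"
      using diffq_step by (intro sum.cong) auto
    then show ?thesis
      using summation_by_parts[of e p N] boundary by simp
  qed
  have "(\<Sum>i=1..N. e i * fv_op \<alpha> \<beta> x y e i)
      = (\<Sum>i=1..N. - (e i * (?D i - ?D (i - 1))) + \<alpha> * (e i * (e i - e (i - 1)))
          + \<beta> * (cell_size y i * (e i)\<^sup>2))"
    by (intro sum.cong) (auto simp: fv_op_flux_form power2_eq_square algebra_simps)
  also have "\<dots> = ?n\<^sup>2 + \<alpha> * (\<Sum>i=1..N. e i * (e i - e (i - 1)))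
      + \<beta> * (\<Sum>i=1..N. cell_size y i * (e i)\<^sup>2)"
    by (simp only: sum.distrib sum_negf parts[of ?D] sum_distrib_left flux_norm_square)
      (simp add: power2_eq_square)
  also have "\<dots> \<ge> ?n\<^sup>2"
  proof -
    have "0 \<le> (\<Sum>i=1..N. cell_size y i * (e i)\<^sup>2)"
      using h_plus_pos h_minus_pos
      by (intro sum_nonneg) (auto simp: cell_size_split less_imp_le)
    then show ?thesis
      using upwind_nonneg[of e N, OF boundary(1)] coeffs by simp
  qed
  finally have "?n\<^sup>2 \<le> (\<Sum>i=1..N. e i * fv_op \<alpha> \<beta> x y e i)" .
  also have "\<dots> = (\<Sum>i=1..N. e i * (P i - P (i - 1)) + e i * Q i)"
    by (intro sum.cong) (auto simp: scheme distrib_left)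
  also have "\<dots> = (\<Sum>i=0..N. - (h_half x i * (P i * ?D i))) + (\<Sum>i=1..N. e i * Q i)"
    by (simp only: sum.distrib parts sum_negf)
  also have "\<dots> \<le> (\<Sum>i=0..N. h_half x i * (\<bar>P i\<bar> * \<bar>?D i\<bar>)) + (\<Sum>i=1..N. ?n * \<bar>Q i\<bar>)"
  proof (intro add_mono sum_mono)
    fix i assume "i \<in> {0..N}"
    then have "0 \<le> h_half x i" using h_half_pos[of i] by simp
    then show "- (h_half x i * (P i * ?D i)) \<le> h_half x i * (\<bar>P i\<bar> * \<bar>?D i\<bar>)"
      using abs_ge_minus_self[of "h_half x i * (P i * ?D i)"] by (simp add: abs_mult)
  next
    fix i assume "i \<in> {1..N}"
    then have "\<bar>e i\<bar> \<le> ?n" using abs_le_flux_norm_diffq[of e i] boundary by simp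
    then have "\<bar>e i\<bar> * \<bar>Q i\<bar> \<le> ?n * \<bar>Q i\<bar>" by (rule mult_right_mono) simp
    then show "e i * Q i \<le> ?n * \<bar>Q i\<bar>"
      using abs_ge_self[of "e i * Q i"] by (simp add: abs_mult)
  qed
  also have "\<dots> \<le> flux_norm N x P * ?n + ?n * (\<Sum>i=1..N. \<bar>Q i\<bar>)"
    using flux_cauchy_schwarz[of P ?D] by (simp add: sum_distrib_left)
  finally have "?n * ?n \<le> ?n * (flux_norm N x P + (\<Sum>i=1..N. \<bar>Q i\<bar>))"
    by (simp add: power2_eq_square algebra_simps)
  moreover have "0 \<le> flux_norm N x P + (\<Sum>i=1..N. \<bar>Q i\<bar>)"
    by (simp add: flux_norm_nonneg sum_nonneg)
  ultimately show ?thesis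
    using flux_norm_nonneg[of N x ?D] by (cases "?n = 0") (auto simp: mult_le_cancel_left)
qed

end

section \<open>Error of the basic solution\<close>

text \<open>Below, \<open>u1\<close>, \<open>u2\<close>, \<open>u3\<close> are the derivatives of \<open>u\<close>, and \<open>W\<close> is an antiderivative, so that
  cell averages of \<open>u\<close> are also treated by Taylor expansion. The equation is required on the closed
  interval since the fluxes at the two boundary faces use it there.\<close>

locale fv_problem = mesh N x y for N :: nat and x y :: "nat \<Rightarrow> real" +
  fixes \<alpha> \<beta> M :: real and W u u1 u2 u3 f :: "real \<Rightarrow> real" and U :: "nat \<Rightarrow> real"
  assumes coeffs: "0 \<le> \<alpha>" "0 \<le> \<beta>"
    and dW: "\<And>t. t \<in> {0..1} \<Longrightarrow> (W has_real_derivative u t) (at t within {0..1})"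
    and du: "\<And>t. t \<in> {0..1} \<Longrightarrow> (u has_real_derivative u1 t) (at t within {0..1})"
    and du1: "\<And>t. t \<in> {0..1} \<Longrightarrow> (u1 has_real_derivative u2 t) (at t within {0..1})"
    and du2: "\<And>t. t \<in> {0..1} \<Longrightarrow> (u2 has_real_derivative u3 t) (at t within {0..1})"
    and bounds: "\<And>t. t \<in> {0..1} \<Longrightarrow> \<bar>u1 t\<bar> \<le> M" "\<And>t. t \<in> {0..1} \<Longrightarrow> \<bar>u2 t\<bar> \<le> M"
      "\<And>t. t \<in> {0..1} \<Longrightarrow> \<bar>u3 t\<bar> \<le> M"
    and equation: "\<And>t. t \<in> {0..1} \<Longrightarrow> f t = - u2 t + \<alpha> * u1 t + \<beta> * u t"
    and boundary: "u 0 = 0" "u 1 = 0"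
    and basic: "fv_solution \<alpha> \<beta> f N x y U"
begin

abbreviation w :: "nat \<Rightarrow> real" where "w \<equiv> \<lambda>i. u (x i)"

abbreviation e0 :: "nat \<Rightarrow> real" where "e0 \<equiv> \<lambda>i. U i - w i"

abbreviation K :: real where "K \<equiv> 1 + \<alpha> + \<beta>"

lemma M_nonneg: "0 \<le> M"
  using bounds(1)[of 0] by simp

lemma mean_value_bound: "\<bar>u t - u s\<bar> \<le> M * \<bar>t - s\<bar>" if "s \<in> {0..1}" "t \<in> {0..1}"
  using taylor_1[of u u1 M s t] du bounds(1) that by blast

lemma cell_balance:
  assumes "1 \<le> i" "i \<le> N"
  shows "integral (cell y i) f = - (u1 (y i) - u1 (y (i - 1)))
    + \<alpha> * (u (y i) - u (y (i - 1))) + \<beta> * (W (y i) - W (y (i - 1)))"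
proof -
  let ?F = "\<lambda>t. - u1 t + \<alpha> * u t + \<beta> * W t"
  have sub: "{y (i - 1)..y i} \<subseteq> {0..1}"
    using y_unit[of i] y_unit[of "i - 1"] assms by auto
  have "(f has_integral ?F (y i) - ?F (y (i - 1))) {y (i - 1)..y i}"
  proof (rule fundamental_theorem_of_calculus)
    show "y (i - 1) \<le> y i"
      using y_mono[of "i - 1" i] assms by simp
    fix t assume t: "t \<in> {y (i - 1)..y i}"
    then have t01: "t \<in> {0..1}" using sub by blast
    have "(?F has_real_derivative f t) (at t within {0..1})"
      unfolding equation[OF t01]
      by (rule derivative_eq_intros du1[OF t01] du[OF t01] dW[OF t01] refl | simp)+
    from has_field_derivative_subset[OF this sub]
    show "(?F has_vector_derivative f t) (at t within {y (i - 1)..y i})"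
      by (simp only: has_real_derivative_iff_has_vector_derivative)
  qed
  then show ?thesis
    unfolding cell_def integral_open_interval_real[symmetric]
    by (simp add: integral_unique algebra_simps)
qed

lemma sq_le_h: "a\<^sup>2 \<le> h * a" if "0 \<le> a" "a \<le> h"
  using that by (simp add: power2_eq_square mult_right_mono)

lemma cube_le_h: "a ^ 3 \<le> h\<^sup>2 * a" if "0 \<le> a" "a \<le> h"
  using that by (simp add: power2_eq_square power3_eq_cube mult_right_mono mult_mono)

lemma diffq_first_order:
  assumes i: "i \<le> N"
  shows "\<bar>diffq x w i - u1 (y i)\<bar> \<le> M * h"
proof -
  let ?a = "h_plus x y i" and ?b = "h_minus x y (i + 1)"
  let ?E = "u (x (i + 1)) - u (y i) - (x (i + 1) - y i) * u1 (y i)"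
  let ?F = "u (x i) - u (y i) - (x i - y i) * u1 (y i)"
  have "\<bar>?E\<bar> \<le> M * (x (i + 1) - y i)\<^sup>2" "\<bar>?F\<bar> \<le> M * (x i - y i)\<^sup>2"
    using taylor_2[of u u1 u2 M] du du1 bounds(2) x_unit[of i] x_unit[of "i + 1"] y_unit[of i] i
    by auto
  moreover have "(x (i + 1) - y i)\<^sup>2 = ?b\<^sup>2" "(x i - y i)\<^sup>2 = ?a\<^sup>2"
    by (simp_all add: h_plus_def h_minus_def power2_commute)
  moreover have "M * ?b\<^sup>2 \<le> M * (h * ?b)" "M * ?a\<^sup>2 \<le> M * (h * ?a)"
    using sq_le_h h_plus_bounds[OF i] h_minus_bounds[OF i] M_nonneg
    by (auto intro!: mult_left_mono)
  ultimately have "\<bar>?E\<bar> \<le> M * h * ?b" "\<bar>?F\<bar> \<le> M * h * ?a"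
    by (simp_all add: mult.assoc)
  then have "\<bar>(?E - ?F) / (?a + ?b)\<bar> \<le> M * h"
    by (rule abs_two_sided_quotient_le) (use h_half_pos[OF i] in \<open>simp add: h_half_split\<close>)
  moreover have "?E - ?F = (?a + ?b) * (diffq x w i - u1 (y i))"
    using diffq_step[OF i, of w] unfolding h_half_split right_diff_distrib
    by (simp add: h_plus_def h_minus_def algebra_simps)
  ultimately show ?thesis
    using h_half_pos[OF i] by (simp only: h_half_split nonzero_mult_div_cancel_left less_imp_neq
        not_sym)
qed

text \<open>The one-point rule at \<open>x i\<close> is only of first order, because \<open>x i\<close> may lie anywhere in its
  cell. Expanding \<open>W\<close> at \<open>x i\<close> towards either face keeps a factor \<open>cell_size y i\<close> in front, which
  makes the errors summable.\<close>

lemma cell_first_order: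
  assumes i: "1 \<le> i" "i \<le> N"
  shows "\<bar>W (y i) - W (y (i - 1)) - cell_size y i * w i\<bar> \<le> M * h * cell_size y i"
proof -
  let ?a = "h_plus x y i" and ?b = "h_minus x y i"
  let ?E = "W (y i) - W (x i) - (y i - x i) * u (x i)"
  let ?F = "W (y (i - 1)) - W (x i) - (y (i - 1) - x i) * u (x i)"
  have "\<bar>?E\<bar> \<le> M * (y i - x i)\<^sup>2" "\<bar>?F\<bar> \<le> M * (y (i - 1) - x i)\<^sup>2"
    using taylor_2[of W u u1 M] dW du bounds(1) x_unit[of i] y_unit[of i] y_unit[of "i - 1"] i
    by auto
  moreover have "(y i - x i)\<^sup>2 = ?a\<^sup>2" "(y (i - 1) - x i)\<^sup>2 = ?b\<^sup>2"
    by (simp_all add: h_plus_def h_minus_def power2_commute)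
  moreover have "M * ?b\<^sup>2 \<le> M * (h * ?b)" "M * ?a\<^sup>2 \<le> M * (h * ?a)"
    using sq_le_h h_plus_bounds[of i] h_minus_bounds[of "i - 1"] M_nonneg i
    by (auto intro!: mult_left_mono)
  moreover have "W (y i) - W (y (i - 1)) - cell_size y i * w i = ?E - ?F"
    by (simp add: cell_size_def algebra_simps)
  ultimately show ?thesis
    by (simp add: cell_size_split algebra_simps)
qed

lemma e0_boundary: "e0 0 = 0" "e0 (N + 1) = 0"
  using basic boundary x_0 x_Suc_N by (auto simp: fv_solution_def)

lemma basic_error: "flux_norm N x (diffq x e0) \<le> K * M * h"
proof -
  define P where "P = (\<lambda>i. diffq x w i - u1 (y i) + \<alpha> * (u (y i) - w i))"
  define Q where "Q = (\<lambda>i. \<beta> * (W (y i) - W (y (i - 1)) - cell_size y i * w i))"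
  have "flux_norm N x (diffq x e0) \<le> flux_norm N x P + (\<Sum>i=1..N. \<bar>Q i\<bar>)"
  proof (rule stability[OF coeffs e0_boundary])
    fix i assume i: "1 \<le> i" "i \<le> N"
    have "fv_op \<alpha> \<beta> x y U i = integral (cell y i) f"
      using basic i by (simp add: fv_solution_def)
    then show "fv_op \<alpha> \<beta> x y e0 i = P i - P (i - 1) + Q i"
      using i by (simp add: fv_op_diff cell_balance fv_op_flux_form[of i _ _ _ _ w] P_def Q_def
          algebra_simps)
  qed
  also have "flux_norm N x P \<le> flux_norm N x (\<lambda>_. (1 + \<alpha>) * M * h)"
  proof (rule flux_norm_mono)
    fix i assume i: "i \<le> N"
    have "\<bar>u (y i) - w i\<bar> \<le> M * h_plus x y i"
      using mean_value_bound[of "x i" "y i"] x_unit[of i] y_unit[of i] h_plus_bounds(1)[of i] i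
      by (simp add: h_plus_def)
    also have "\<dots> \<le> M * h"
      using h_plus_bounds(2)[OF i] M_nonneg by (rule mult_left_mono)
    finally have "\<alpha> * \<bar>u (y i) - w i\<bar> \<le> \<alpha> * (M * h)"
      using coeffs(1) by (rule mult_left_mono)
    then have "\<bar>\<alpha> * (u (y i) - w i)\<bar> \<le> \<alpha> * (M * h)"
      using coeffs(1) by (simp add: abs_mult)
    with diffq_first_order[OF i] show "\<bar>P i\<bar> \<le> (1 + \<alpha>) * M * h"
      unfolding P_def by (simp add: algebra_simps)
  qed
  also have "\<dots> = (1 + \<alpha>) * M * h"
    using coeffs M_nonneg h_pos by (simp add: flux_norm_const)
  also have "(\<Sum>i=1..N. \<bar>Q i\<bar>) \<le> (\<Sum>i=1..N. \<beta> * M * h * cell_size y i)"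
  proof (rule sum_mono)
    fix i assume "i \<in> {1..N}"
    then have "\<bar>W (y i) - W (y (i - 1)) - cell_size y i * w i\<bar> \<le> M * h * cell_size y i"
      using cell_first_order by simp
    then have "\<beta> * \<bar>W (y i) - W (y (i - 1)) - cell_size y i * w i\<bar>
        \<le> \<beta> * (M * h * cell_size y i)"
      using coeffs(2) by (rule mult_left_mono)
    then show "\<bar>Q i\<bar> \<le> \<beta> * M * h * cell_size y i"
      unfolding Q_def using coeffs(2) by (simp add: abs_mult mult.assoc)
  qed
  also have "\<dots> = \<beta> * M * h"
    by (simp only: sum_cell_size mult_1_right flip: sum_distrib_left)
  finally show ?thesis by (simp add: algebra_simps)
qed

section \<open>Error of the first correction\<close>

lemma diffq_second_order:
  assumes i: "i \<le> N"
  shows "\<bar>diffq x w i - u1 (y i) - (h_minus x y (i + 1) - h_plus x y i) / 2 * u2 (y i)\<bar>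
    \<le> M / 2 * h\<^sup>2"
proof -
  let ?a = "h_plus x y i" and ?b = "h_minus x y (i + 1)"
  let ?E = "u (x (i + 1)) - u (y i) - (x (i + 1) - y i) * u1 (y i)
    - (x (i + 1) - y i)\<^sup>2 / 2 * u2 (y i)"
  let ?F = "u (x i) - u (y i) - (x i - y i) * u1 (y i) - (x i - y i)\<^sup>2 / 2 * u2 (y i)"
  have "\<bar>?E\<bar> \<le> M / 2 * \<bar>x (i + 1) - y i\<bar> ^ 3" "\<bar>?F\<bar> \<le> M / 2 * \<bar>x i - y i\<bar> ^ 3"
    using taylor_3[of u u1 u2 u3 M] du du1 du2 bounds(3) x_unit[of i] x_unit[of "i + 1"]
      y_unit[of i] i
    by auto
  moreover have "\<bar>x (i + 1) - y i\<bar> = ?b" "\<bar>x i - y i\<bar> = ?a"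
    using h_plus_bounds(1)[OF i] h_minus_bounds(1)[OF i] by (simp_all add: h_plus_def h_minus_def)
  moreover have "M / 2 * ?b ^ 3 \<le> M / 2 * (h\<^sup>2 * ?b)" "M / 2 * ?a ^ 3 \<le> M / 2 * (h\<^sup>2 * ?a)"
    using cube_le_h h_plus_bounds[OF i] h_minus_bounds[OF i] M_nonneg
    by (auto intro!: mult_left_mono)
  ultimately have "\<bar>?E\<bar> \<le> M / 2 * h\<^sup>2 * ?b" "\<bar>?F\<bar> \<le> M / 2 * h\<^sup>2 * ?a"
    by (simp_all add: mult.assoc)
  then have "\<bar>(?E - ?F) / (?a + ?b)\<bar> \<le> M / 2 * h\<^sup>2"
    by (rule abs_two_sided_quotient_le) (use h_half_pos[OF i] in \<open>simp add: h_half_split\<close>)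
  moreover have "?E - ?F = (?a + ?b) * (diffq x w i - u1 (y i) - (?b - ?a) / 2 * u2 (y i))"
    using diffq_step[OF i, of w] unfolding h_half_split right_diff_distrib
    by (simp add: h_plus_def h_minus_def field_simps power2_eq_square)
  ultimately show ?thesis
    using h_half_pos[OF i] by (simp only: h_half_split nonzero_mult_div_cancel_left less_imp_neq
        not_sym)
qed

lemma cell_second_order:
  assumes i: "1 \<le> i" "i \<le> N"
  shows "\<bar>W (y i) - W (y (i - 1)) - cell_size y i * w i
      - ((h_plus x y i)\<^sup>2 - (h_minus x y i)\<^sup>2) / 2 * u1 (x i)\<bar> \<le> M / 2 * h\<^sup>2 * cell_size y i"
proof -
  let ?a = "h_plus x y i" and ?b = "h_minus x y i"
  let ?E = "W (y i) - W (x i) - (y i - x i) * u (x i) - (y i - x i)\<^sup>2 / 2 * u1 (x i)"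
  let ?F = "W (y (i - 1)) - W (x i) - (y (i - 1) - x i) * u (x i)
    - (y (i - 1) - x i)\<^sup>2 / 2 * u1 (x i)"
  have "\<bar>?E\<bar> \<le> M / 2 * \<bar>y i - x i\<bar> ^ 3" "\<bar>?F\<bar> \<le> M / 2 * \<bar>y (i - 1) - x i\<bar> ^ 3"
    using taylor_3[of W u u1 u2 M] dW du du1 bounds(2) x_unit[of i] y_unit[of i]
      y_unit[of "i - 1"] i
    by auto
  moreover have "\<bar>y i - x i\<bar> = ?a" "\<bar>y (i - 1) - x i\<bar> = ?b"
    using node_between[OF i] by (simp_all add: h_plus_def h_minus_def)
  moreover have "M / 2 * ?b ^ 3 \<le> M / 2 * (h\<^sup>2 * ?b)" "M / 2 * ?a ^ 3 \<le> M / 2 * (h\<^sup>2 * ?a)"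
    using cube_le_h h_plus_bounds[of i] h_minus_bounds[of "i - 1"] M_nonneg i
    by (auto intro!: mult_left_mono)
  ultimately have "\<bar>?E\<bar> \<le> M / 2 * h\<^sup>2 * ?a" "\<bar>?F\<bar> \<le> M / 2 * h\<^sup>2 * ?b"
    by (simp_all only: mult.assoc)
  moreover have "\<bar>?E - ?F\<bar> \<le> \<bar>?E\<bar> + \<bar>?F\<bar>"
    by (rule abs_triangle_ineq4)
  ultimately have "\<bar>?E - ?F\<bar> \<le> M / 2 * h\<^sup>2 * cell_size y i"
    unfolding cell_size_split distrib_left by linarith
  moreover have "?E - ?F = W (y i) - W (y (i - 1)) - cell_size y i * w i
      - (?a\<^sup>2 - ?b\<^sup>2) / 2 * u1 (x i)"
    by (simp only: cell_size_def h_plus_def h_minus_def power2_commute[of "y (i - 1)"])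
      (simp add: algebra_simps diff_divide_distrib)
  ultimately show ?thesis
    by (simp only:)
qed

text \<open>The quantities that the correction takes from the basic solution, compared with those of
  the exact solution that they stand for.\<close>

lemma diffq_U_face: "\<bar>diffq x U i - u1 (y i)\<bar> \<le> \<bar>diffq x e0 i\<bar> + M * h" if "i \<le> N"
  using diffq_first_order[OF that] diffq_diff[of x U w i] by linarith

lemma U_face: "\<bar>U i - u (y i)\<bar> \<le> (K + 1) * M * h" if "i \<le> N"
proof -
  have "\<bar>e0 i\<bar> \<le> K * M * h"
    using abs_le_flux_norm_diffq[of e0 i] e0_boundary(1) basic_error that by simp
  moreover have "\<bar>w i - u (y i)\<bar> \<le> M * h_plus x y i"
    using mean_value_bound[of "y i" "x i"] x_unit[of i] y_unit[of i] h_plus_bounds(1)[of i] that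
    by (simp add: h_plus_def)
  moreover have "M * h_plus x y i \<le> M * h"
    using h_plus_bounds(2)[OF that] M_nonneg by (rule mult_left_mono)
  ultimately show ?thesis
    by (simp add: algebra_simps)
qed

lemma diffq_U_node:
  assumes i: "i \<le> N" and s: "s = x i \<or> s = x (i + 1)"
  shows "\<bar>diffq x U i - u1 s\<bar> \<le> \<bar>diffq x e0 i\<bar> + 2 * M * h"
proof -
  have "s \<in> {0..1}" and "\<bar>y i - s\<bar> \<le> h"
    using s x_unit[of i] x_unit[of "i + 1"] i h_plus_bounds[OF i] h_minus_bounds[OF i]
    by (auto simp: h_plus_def h_minus_def)
  then have "\<bar>u1 (y i) - u1 s\<bar> \<le> M * \<bar>y i - s\<bar>" "M * \<bar>y i - s\<bar> \<le> M * h"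
    using taylor_1[of u1 u2 M s "y i"] du1 bounds(2) y_unit[OF i] M_nonneg
    by (auto intro!: mult_left_mono)
  then show ?thesis
    using diffq_U_face[OF i] by linarith
qed

text \<open>The remaining flux error of the correction. Replacing \<open>f (y i)\<close> by the differential equation turns
  \<open>\<alpha> * diffq x U i + \<beta> * U i - f (y i)\<close> into \<open>u2 (y i)\<close> plus errors of the basic solution, so
  the skewness term cancels the second Taylor coefficient of the diffusive flux.\<close>

definition corr_flux :: "nat \<Rightarrow> real" where
  "corr_flux i = diffq x w i - u1 (y i)
    - (h_minus x y (i + 1) - h_plus x y i) / 2 * (\<alpha> * diffq x U i + \<beta> * U i - f (y i))
    + \<alpha> * (u (y i) - w i) - \<alpha> * h_plus x y i * diffq x U i"

definition corr_volume :: "nat \<Rightarrow> real" where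
  "corr_volume i = \<beta> * (W (y i) - W (y (i - 1)) - cell_size y i * w i)
    - \<beta> / 2 * ((h_plus x y i)\<^sup>2 * diffq x U i - (h_minus x y i)\<^sup>2 * diffq x U (i - 1))"

lemma corr_flux_bound:
  assumes i: "i \<le> N"
  shows "\<bar>corr_flux i\<bar>
    \<le> (1 + 5 / 2 * \<alpha> + \<beta> / 2 * (K + 1)) * M * h\<^sup>2 + 3 / 2 * \<alpha> * h * \<bar>diffq x e0 i\<bar>"
proof -
  let ?a = "h_plus x y i"
  let ?s = "(h_minus x y (i + 1) - h_plus x y i) / 2"
  let ?d = "\<bar>diffq x e0 i\<bar>"
  let ?dD = "diffq x U i - u1 (y i)" and ?dU = "U i - u (y i)"
  let ?T = "diffq x w i - u1 (y i) - ?s * u2 (y i)"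
  let ?R = "u (y i) - w i - ?a * u1 (y i)"
  have decomp: "corr_flux i = ?T - ?s * (\<alpha> * ?dD + \<beta> * ?dU) + \<alpha> * ?R - \<alpha> * (?a * ?dD)"
    unfolding corr_flux_def equation[OF y_unit[OF i]] by (simp add: algebra_simps)
  have T: "\<bar>?T\<bar> \<le> M / 2 * h\<^sup>2"
    by (rule diffq_second_order[OF i])
  have R: "\<bar>?R\<bar> \<le> M * h\<^sup>2"
  proof -
    have "\<bar>u (x i) - u (y i) - (x i - y i) * u1 (y i)\<bar> \<le> M * (x i - y i)\<^sup>2"
      using taylor_2[of u u1 u2 M] du du1 bounds(2) x_unit[of i] y_unit[of i] i by auto
    moreover have "u (x i) - u (y i) - (x i - y i) * u1 (y i) = - ?R"
      by (simp add: h_plus_def algebra_simps)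
    moreover have "M * (x i - y i)\<^sup>2 \<le> M * h\<^sup>2"
      using h_plus_bounds[OF i] M_nonneg
      by (intro mult_left_mono) (simp_all add: h_plus_def power2_commute[of "x i"] power_mono)
    ultimately show ?thesis by simp
  qed
  have "\<bar>?s * (\<alpha> * ?dD + \<beta> * ?dU)\<bar> \<le> h / 2 * (\<alpha> * (?d + M * h) + \<beta> * ((K + 1) * M * h))"
    unfolding abs_mult
  proof (rule mult_mono)
    show "\<bar>?s\<bar> \<le> h / 2"
      using h_plus_bounds[OF i] h_minus_bounds[OF i] by (simp add: abs_le_iff)
    have "\<bar>\<alpha> * ?dD\<bar> \<le> \<alpha> * (?d + M * h)" "\<bar>\<beta> * ?dU\<bar> \<le> \<beta> * ((K + 1) * M * h)"
      using diffq_U_face[OF i] U_face[OF i] coeffs by (auto simp: abs_mult intro!: mult_left_mono)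
    then show "\<bar>\<alpha> * ?dD + \<beta> * ?dU\<bar> \<le> \<alpha> * (?d + M * h) + \<beta> * ((K + 1) * M * h)"
      by linarith
  qed (use h_pos in auto)
  moreover have "\<bar>\<alpha> * ?R\<bar> \<le> \<alpha> * (M * h\<^sup>2)"
    using R coeffs(1) by (simp add: abs_mult mult_left_mono)
  moreover have "\<bar>\<alpha> * (?a * ?dD)\<bar> \<le> \<alpha> * (h * (?d + M * h))"
    using diffq_U_face[OF i] h_plus_bounds[OF i] coeffs(1) h_pos
    by (auto simp: abs_mult intro!: mult_left_mono mult_mono)
  moreover have "0 \<le> M * h\<^sup>2" using M_nonneg by simp
  ultimately have "\<bar>corr_flux i\<bar> \<le> M * h\<^sup>2
      + h / 2 * (\<alpha> * (?d + M * h) + \<beta> * ((K + 1) * M * h))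
      + \<alpha> * (M * h\<^sup>2) + \<alpha> * (h * (?d + M * h))"
    unfolding decomp using T by linarith
  also have "\<dots> = (1 + 5 / 2 * \<alpha> + \<beta> / 2 * (K + 1)) * M * h\<^sup>2 + 3 / 2 * \<alpha> * h * ?d"
    by (simp add: field_simps power2_eq_square)
  finally show ?thesis .
qed

lemma corr_volume_bound:
  assumes i: "1 \<le> i" "i \<le> N"
  shows "\<bar>corr_volume i\<bar> \<le> 3 / 2 * \<beta> * M * h\<^sup>2 * cell_size y i
    + \<beta> / 2 * h * (h_plus x y i * \<bar>diffq x e0 i\<bar> + h_minus x y i * \<bar>diffq x e0 (i - 1)\<bar>)"
proof -
  let ?a = "h_plus x y i" and ?b = "h_minus x y i"
  let ?d = "\<bar>diffq x e0 i\<bar>" and ?d' = "\<bar>diffq x e0 (i - 1)\<bar>"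
  let ?dD = "diffq x U i - u1 (x i)" and ?dD' = "diffq x U (i - 1) - u1 (x i)"
  let ?T = "W (y i) - W (y (i - 1)) - cell_size y i * w i - (?a\<^sup>2 - ?b\<^sup>2) / 2 * u1 (x i)"
  have ab: "0 \<le> ?a" "?a \<le> h" "0 \<le> ?b" "?b \<le> h"
    using h_plus_bounds[of i] h_minus_bounds[of "i - 1"] i by auto
  have "\<bar>?dD\<bar> \<le> ?d + 2 * M * h"
    using diffq_U_node[of i "x i"] i by simp
  then have a: "\<bar>?a\<^sup>2 * ?dD\<bar> \<le> h * ?a * (?d + 2 * M * h)"
    using sq_le_h[OF ab(1,2)] ab h_pos by (auto simp: abs_mult intro!: mult_mono)
  have "\<bar>?dD'\<bar> \<le> ?d' + 2 * M * h"
    using diffq_U_node[of "i - 1" "x i"] i by simp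
  then have b: "\<bar>?b\<^sup>2 * ?dD'\<bar> \<le> h * ?b * (?d' + 2 * M * h)"
    using sq_le_h[OF ab(3,4)] ab h_pos by (auto simp: abs_mult intro!: mult_mono)
  have triangle: "\<bar>t - p / 2 + q / 2\<bar> \<le> t' + p' / 2 + q' / 2"
    if "\<bar>t\<bar> \<le> t'" "\<bar>p\<bar> \<le> p'" "\<bar>q\<bar> \<le> q'" for t p q t' p' q' :: real
    using that by linarith
  have "corr_volume i = \<beta> * (?T - ?a\<^sup>2 * ?dD / 2 + ?b\<^sup>2 * ?dD' / 2)"
    unfolding corr_volume_def by (simp add: field_simps)
  then have "\<bar>corr_volume i\<bar> = \<beta> * \<bar>?T - ?a\<^sup>2 * ?dD / 2 + ?b\<^sup>2 * ?dD' / 2\<bar>"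
    using coeffs(2) by (simp add: abs_mult)
  also have "\<dots> \<le> \<beta> * (M / 2 * h\<^sup>2 * cell_size y i + h * ?a * (?d + 2 * M * h) / 2
      + h * ?b * (?d' + 2 * M * h) / 2)"
    by (rule mult_left_mono[OF triangle[OF cell_second_order[OF i] a b] coeffs(2)])
  also have "\<dots> = 3 / 2 * \<beta> * M * h\<^sup>2 * cell_size y i
      + \<beta> / 2 * h * (?a * ?d + ?b * ?d')"
    by (simp add: cell_size_split field_simps power2_eq_square)
  finally show ?thesis .
qed

text \<open>The two cell pieces next to a face make up the step across it, so regrouping by face gives
  the weights of \<open>flux_norm\<close>.\<close>

lemma sum_cell_pieces_le:
  "(\<Sum>i=1..N. h_plus x y i * \<bar>p i\<bar> + h_minus x y i * \<bar>p (i - 1)\<bar>) \<le> flux_norm N x p"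
proof -
  have "(\<Sum>i=1..N. h_plus x y i * \<bar>p i\<bar>) \<le> (\<Sum>i=0..N. h_plus x y i * \<bar>p i\<bar>)"
    using h_plus_bounds by (intro sum_mono2) auto
  moreover have "(\<Sum>i=1..N. h_minus x y i * \<bar>p (i - 1)\<bar>)
      \<le> (\<Sum>i=0..N. h_minus x y (i + 1) * \<bar>p i\<bar>)"
  proof -
    have "(\<Sum>i=1..N. h_minus x y i * \<bar>p (i - 1)\<bar>) = (\<Sum>i<N. h_minus x y (i + 1) * \<bar>p i\<bar>)"
      by (rule sum.reindex_bij_witness[of _ "\<lambda>i. i + 1" "\<lambda>i. i - 1"]) auto
    also have "\<dots> \<le> (\<Sum>i=0..N. h_minus x y (i + 1) * \<bar>p i\<bar>)"
      using h_minus_bounds by (intro sum_mono2) auto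
    finally show ?thesis .
  qed
  ultimately have "(\<Sum>i=1..N. h_plus x y i * \<bar>p i\<bar> + h_minus x y i * \<bar>p (i - 1)\<bar>)
      \<le> (\<Sum>i=0..N. h_half x i * \<bar>p i\<bar>)"
    by (simp add: sum.distrib h_half_split distrib_right)
  also have "\<dots> \<le> flux_norm N x p"
    by (rule flux_sum_le)
  finally show ?thesis .
qed

lemma correction_error:
  assumes V: "first_correction \<alpha> \<beta> f N x y U V"
  shows "flux_norm N x (diffq x (\<lambda>i. V i - w i)) \<le> 4 * K\<^sup>2 * M * h\<^sup>2"
proof -
  let ?n = "flux_norm N x (diffq x e0)"
  let ?c = "(1 + 5 / 2 * \<alpha> + \<beta> / 2 * (K + 1)) * M * h\<^sup>2"
  have "flux_norm N x (diffq x (\<lambda>i. V i - w i))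
      \<le> flux_norm N x corr_flux + (\<Sum>i=1..N. \<bar>corr_volume i\<bar>)"
  proof (rule stability[OF coeffs])
    show "V 0 - w 0 = 0" "V (N + 1) - w (N + 1) = 0"
      using V boundary x_0 x_Suc_N by (auto simp: first_correction_def)
    fix i assume i: "1 \<le> i" "i \<le> N"
    then have "i - 1 + 1 = i" by simp
    with i show "fv_op \<alpha> \<beta> x y (\<lambda>i. V i - w i) i
        = corr_flux i - corr_flux (i - 1) + corr_volume i"
      using V by (simp add: first_correction_def fv_op_diff cell_balance
          fv_op_flux_form[of i _ _ _ _ w] corr_flux_def corr_volume_def algebra_simps)
  qed
  also have "flux_norm N x corr_flux \<le> ?c + 3 / 2 * \<alpha> * h * ?n"
  proof -
    have "flux_norm N x corr_flux
        \<le> flux_norm N x (\<lambda>i. ?c + 3 / 2 * \<alpha> * h * \<bar>diffq x e0 i\<bar>)"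
      by (rule flux_norm_mono) (rule corr_flux_bound)
    also have "\<dots> \<le> flux_norm N x (\<lambda>_. ?c)
        + flux_norm N x (\<lambda>i. 3 / 2 * \<alpha> * h * \<bar>diffq x e0 i\<bar>)"
      by (rule flux_norm_triangle)
    also have "flux_norm N x (\<lambda>_. ?c) = ?c"
      using coeffs M_nonneg by (simp add: flux_norm_const)
    also have "flux_norm N x (\<lambda>i. 3 / 2 * \<alpha> * h * \<bar>diffq x e0 i\<bar>) = 3 / 2 * \<alpha> * h * ?n"
      using coeffs h_pos by (subst flux_norm_scale) (simp_all add: flux_norm_abs)
    finally show ?thesis .
  qed
  also have "(\<Sum>i=1..N. \<bar>corr_volume i\<bar>) \<le> 3 / 2 * \<beta> * M * h\<^sup>2 + \<beta> / 2 * h * ?n"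
  proof -
    have "(\<Sum>i=1..N. \<bar>corr_volume i\<bar>) \<le> (\<Sum>i=1..N. 3 / 2 * \<beta> * M * h\<^sup>2 * cell_size y i
        + \<beta> / 2 * h * (h_plus x y i * \<bar>diffq x e0 i\<bar> + h_minus x y i * \<bar>diffq x e0 (i - 1)\<bar>))"
      by (rule sum_mono) (use corr_volume_bound in auto)
    also have "\<dots> = 3 / 2 * \<beta> * M * h\<^sup>2 + \<beta> / 2 * h *
        (\<Sum>i=1..N. h_plus x y i * \<bar>diffq x e0 i\<bar> + h_minus x y i * \<bar>diffq x e0 (i - 1)\<bar>)"
      by (simp only: sum.distrib[of "\<lambda>i. 3 / 2 * \<beta> * M * h\<^sup>2 * cell_size y i"]
          sum_distrib_left[symmetric] sum_cell_size mult_1_right)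
    also have "\<dots> \<le> 3 / 2 * \<beta> * M * h\<^sup>2 + \<beta> / 2 * h * ?n"
      using sum_cell_pieces_le[of "diffq x e0"] coeffs(2) h_pos
      by (intro add_left_mono mult_left_mono) auto
    finally show ?thesis .
  qed
  finally have "flux_norm N x (diffq x (\<lambda>i. V i - w i))
      \<le> ?c + 3 / 2 * \<alpha> * h * ?n + (3 / 2 * \<beta> * M * h\<^sup>2 + \<beta> / 2 * h * ?n)"
    by simp
  also have "\<dots> \<le> ?c + 3 / 2 * \<alpha> * h * (K * M * h)
      + (3 / 2 * \<beta> * M * h\<^sup>2 + \<beta> / 2 * h * (K * M * h))"
    using basic_error coeffs h_pos
    by (intro add_mono order_refl mult_left_mono[OF basic_error]) auto
  also have "\<dots> = (1 + 5 / 2 * \<alpha> + \<beta> / 2 * (K + 1) + 3 / 2 * \<alpha> * K + 3 / 2 * \<beta>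
      + \<beta> / 2 * K) * (M * h\<^sup>2)"
    by (simp add: field_simps power2_eq_square)
  \<comment> \<open>With \<open>1 \<le> K\<close>, the terms without \<open>K\<close> add up to at most \<open>5 / 2 * K\<close> and the
    others to at most \<open>3 / 2 * K\<^sup>2\<close>.\<close>
  also have "\<dots> \<le> (4 * K\<^sup>2) * (M * h\<^sup>2)"
  proof (rule mult_right_mono)
    have "0 \<le> \<alpha> * \<alpha>" "0 \<le> \<alpha> * \<beta>" "0 \<le> \<beta> * \<beta>" using coeffs by auto
    then show "1 + 5 / 2 * \<alpha> + \<beta> / 2 * (K + 1) + 3 / 2 * \<alpha> * K + 3 / 2 * \<beta> + \<beta> / 2 * K
        \<le> 4 * K\<^sup>2"
      using coeffs by (simp add: power2_eq_square field_simps)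
  qed (use M_nonneg in simp)
  finally show ?thesis by (simp add: mult.assoc)
qed

end

section \<open>Smooth solutions of the boundary value problem\<close>

lemma C_on_has_derivative:
  assumes "C_on m {0..1} u" "k < m" "t \<in> {0..1}"
  shows "(nderiv_on {0..1} k u has_real_derivative nderiv_on {0..1} (Suc k) u t)
    (at t within {0..1})"
  using assms
  by (auto simp: C_on_def differentiable_on_def nderiv_on_def vector_derivative_works
      has_real_derivative_iff_has_vector_derivative)

lemma abs_nderiv_le_Cnorm:
  assumes "C_on m {0..1} u" "k \<le> m" "t \<in> {0..1}"
  shows "\<bar>nderiv_on {0..1} k u t\<bar> \<le> Cnorm m {0..1} u"
proof -
  have "compact ((\<lambda>t. \<bar>nderiv_on {0..1} k u t\<bar>) ` {0..1})"
    using assms(1,2)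
    by (intro compact_continuous_image continuous_on_rabs) (auto simp: C_on_def)
  then have "bdd_above ((\<lambda>t. \<bar>nderiv_on {0..1} k u t\<bar>) ` {0..1})"
    by (intro bounded_imp_bdd_above compact_imp_bounded)
  then have "\<bar>nderiv_on {0..1} k u t\<bar> \<le> (SUP t\<in>{0..1}. \<bar>nderiv_on {0..1} k u t\<bar>)"
    using assms(3) by (intro cSUP_upper) auto
  also have "\<dots> \<le> Cnorm m {0..1} u"
    unfolding Cnorm_def using assms(2) by (intro Max_ge) auto
  finally show ?thesis .
qed

text \<open>Both sides are continuous on the closed interval and agree on a dense subset.\<close>

lemma bvp_equation_closed:
  assumes C: "C_on 2 {0..1} u" and sol: "bvp_solution \<alpha> \<beta> f u" and t: "t \<in> {0..1}"
  shows "f t = - nderiv_on {0..1} 2 u t + \<alpha> * nderiv_on {0..1} 1 u t + \<beta> * u t"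
proof -
  let ?g = "\<lambda>t. f t - (- nderiv_on {0..1} 2 u t + \<alpha> * nderiv_on {0..1} 1 u t
    + \<beta> * nderiv_on {0..1} 0 u t)"
  have cont: "continuous_on {0..1} (nderiv_on {0..1} k u)" if "k \<le> 2" for k
    using C that by (simp add: C_on_def)
  have closure: "closure {0<..<1::real} = {0..1}" by simp
  have "?g t = 0"
  proof (rule continuous_constant_on_closure[of "{0<..<1}" ?g 0])
    show "continuous_on (closure {0<..<1}) ?g"
      unfolding closure using sol
      by (intro continuous_intros cont) (auto simp: bvp_solution_def)
    show "?g s = 0" if "s \<in> {0<..<1}" for s
      using sol that by (simp add: bvp_solution_def nderiv_on_def[of _ 0])
  qed (use t closure in simp)
  then show ?thesis by (simp add: nderiv_on_def[of _ 0])
qed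

theorem theorem2p2:
  fixes \<alpha> \<beta> :: real
  assumes "0 \<le> \<alpha>" and "0 \<le> \<beta>"
  shows "\<exists>c>0. \<forall>(u :: real \<Rightarrow> real) (f :: real \<Rightarrow> real).
           C_on 3 {0..1} u \<and> bvp_solution \<alpha> \<beta> f u \<longrightarrow>
           (\<forall>(N :: nat) (x :: nat \<Rightarrow> real) (y :: nat \<Rightarrow> real) (U :: nat \<Rightarrow> real) (V :: nat \<Rightarrow> real).
              admissible_mesh N x y \<and> fv_solution \<alpha> \<beta> f N x y U \<and>
              first_correction \<alpha> \<beta> f N x y U V \<longrightarrow>
              (let e = (\<lambda>i. V i - u (x i)) in
                 sqrt (\<Sum>i=0..N. (e (i + 1) - e i)^2 / h_half x i)
                   \<le> c * (mesh_size N y)^2 * Cnorm 3 {0..1} u))"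
proof (intro exI conjI allI impI)
  show "0 < 4 * (1 + \<alpha> + \<beta>)\<^sup>2"
    using assms by (simp add: add_pos_nonneg)
  fix u f N x y U V
  assume uf: "C_on 3 {0..1} u \<and> bvp_solution \<alpha> \<beta> f u"
    and m: "admissible_mesh N x y \<and> fv_solution \<alpha> \<beta> f N x y U \<and> first_correction \<alpha> \<beta> f N x y U V"
  let ?d = "\<lambda>k. nderiv_on {0..1} k u"
  have d0: "?d 0 = u" by (simp add: nderiv_on_def)
  have C2: "C_on 2 {0..1} u" using uf by (simp add: C_on_def)
  have "continuous_on {0..1} (?d 0)" using uf unfolding C_on_def by blast
  then have "continuous_on {0..1} u" by (simp add: d0)
  then obtain W where W: "\<And>t. t \<in> {0..1} \<Longrightarrow> (W has_vector_derivative u t) (at t within {0..1})"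
    using antiderivative_continuous by blast
  have deriv: "(?d k has_real_derivative ?d (Suc k) t) (at t within {0..1})"
    if "k < 3" "t \<in> {0..1}" for k t
    using C_on_has_derivative uf that by blast
  have bound: "\<bar>?d k t\<bar> \<le> Cnorm 3 {0..1} u" if "k \<le> 3" "t \<in> {0..1}" for k t
    using abs_nderiv_le_Cnorm uf that by blast
  interpret fv_problem N x y \<alpha> \<beta> "Cnorm 3 {0..1} u" W u "?d 1" "?d 2" "?d 3" f U
  proof
    show "admissible_mesh N x y" "fv_solution \<alpha> \<beta> f N x y U" using m by auto
    show "u 0 = 0" "u 1 = 0" using uf by (auto simp: bvp_solution_def)
    fix t :: real assume t: "t \<in> {0..1}"
    show "(W has_real_derivative u t) (at t within {0..1})"
      using W[OF t] by (simp add: has_real_derivative_iff_has_vector_derivative)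
    show "(u has_real_derivative ?d 1 t) (at t within {0..1})"
      using deriv[of 0, OF _ t] by (simp add: d0)
    show "(?d 1 has_real_derivative ?d 2 t) (at t within {0..1})"
      using deriv[of 1, OF _ t] by (simp add: numeral_2_eq_2)
    show "(?d 2 has_real_derivative ?d 3 t) (at t within {0..1})"
      using deriv[of 2, OF _ t] by (simp add: numeral_2_eq_2 numeral_3_eq_3)
    show "\<bar>?d 1 t\<bar> \<le> Cnorm 3 {0..1} u" "\<bar>?d 2 t\<bar> \<le> Cnorm 3 {0..1} u"
      "\<bar>?d 3 t\<bar> \<le> Cnorm 3 {0..1} u"
      using bound t by auto
    show "f t = - ?d 2 t + \<alpha> * ?d 1 t + \<beta> * u t"
      using bvp_equation_closed[OF C2 _ t] uf by blast
  qed (use assms in auto)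
  show "let e = \<lambda>i. V i - u (x i) in
      sqrt (\<Sum>i=0..N. (e (i + 1) - e i)^2 / h_half x i)
        \<le> 4 * (1 + \<alpha> + \<beta>)\<^sup>2 * (mesh_size N y)^2 * Cnorm 3 {0..1} u"
    using correction_error[of V] m
    unfolding Let_def flux_norm_diffq by (simp add: mult_ac)
qed

end
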